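(* Let $G$ be a finite connected chordal graph such that the independence complex $\mathrm{Ind}(G)$ is contractible. Then either $G$ is a single vertex, or for every rooted tree model $(T,R)$ of $G$ there exists a $(T,R)$-good pair $(x,y)$ in $G$.
   Context: A graph is chordal if it has no induced cycle of length more than three. $\mathrm{Ind}(G)$ is the simplicial complex on $V(G)$ whose faces are the independent sets. A pair $(x,y)$ of distinct vertices is good in $G$ if $N_G(x)\subseteq N_G(y)$ (open neighbourhoods). A tree model of $G$ is a finite tree $T$ (whose vertices are called nodes) such that each node contains a (possibly empty) subset of $V(G)$, for each $v\in V(G)$ the nodes containing $v$ (called $v$-nodes) form a subtree of $T$, and $vw\in E(G)$ iff some node contains both $v$ and $w$. A rooted tree model $(T,R)$ is a tree model with a marked node $R$. A pair $(x,y)$ is $(T,R)$-good in $G$ if it is good in $G$ and the shortest path in $T$ from any $x$-node to $R$ contains some $y$-node. *)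

theory Defs
  imports "HOL-Analysis.Analysis" "Graph_Theory.Graph_Theory"
begin

text \<open>
  Finite simple graphs are the finite symmetric digraphs without loops and parallel arcs
  (\<^locale>\<open>graph\<close>). The library predicate \<^const>\<open>tree\<close> is a digraph notion: in a symmetric
  digraph \<open>a, b, a\<close> is a directed cycle, so any symmetric digraph with an edge fails it.
  Cycles and trees are therefore defined here in the undirected sense, a cycle being the list
  of its (at least three) distinct vertices.
\<close>

definition ucycle :: "('a, 'e) pre_digraph \<Rightarrow> 'a list \<Rightarrow> bool" where
  "ucycle G c \<longleftrightarrow> 3 \<le> length c \<and> distinct c \<and> vwalk (c @ [hd c]) G"

definition utree :: "('a, 'e) pre_digraph \<Rightarrow> bool" where
  "utree G \<longleftrightarrow> Digraph_Component.connected G \<and> \<not> (\<exists>c. ucycle G c)"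

definition induced_ucycle :: "('a, 'e) pre_digraph \<Rightarrow> 'a list \<Rightarrow> bool" where
  "induced_ucycle G c \<longleftrightarrow> ucycle G c \<and>
     (\<forall>u \<in> set c. \<forall>v \<in> set c. u \<rightarrow>\<^bsub>G\<^esub> v \<longrightarrow>
        (u, v) \<in> set (vwalk_arcs (c @ [hd c])) \<or> (v, u) \<in> set (vwalk_arcs (c @ [hd c])))"

definition chordal :: "('a, 'e) pre_digraph \<Rightarrow> bool" where
  "chordal G \<longleftrightarrow> \<not> (\<exists>c. induced_ucycle G c \<and> length c > 3)"

definition Ind :: "('a, 'e) pre_digraph \<Rightarrow> 'a set set" where
  "Ind G = {S. S \<subseteq> verts G \<and> (\<forall>u \<in> S. \<forall>v \<in> S. \<not> u \<rightarrow>\<^bsub>G\<^esub> v)}"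

text \<open>
  Geometric realization in barycentric coordinates. Faces are expected to be finite; for a
  complex with finitely many vertices the topology of pointwise convergence used here is the
  usual one.
\<close>

definition realization :: "'a set set \<Rightarrow> ('a \<Rightarrow> real) topology" where
  "realization K = subtopology (powertop_real UNIV)
     {f. (\<forall>v. 0 \<le> f v) \<and> {v. f v \<noteq> 0} \<in> K \<and> (\<Sum>v | f v \<noteq> 0. f v) = 1}"

definition nbhd :: "('a, 'e) pre_digraph \<Rightarrow> 'a \<Rightarrow> 'a set" where
  "nbhd G x = {v \<in> verts G. x \<rightarrow>\<^bsub>G\<^esub> v}"

definition good_pair :: "('a, 'e) pre_digraph \<Rightarrow> 'a \<Rightarrow> 'a \<Rightarrow> bool" where
  "good_pair G x y \<longleftrightarrow>
     x \<in> verts G \<and> y \<in> verts G \<and> x \<noteq> y \<and> nbhd G x \<subseteq> nbhd G y"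

text \<open>A tree model is a tree \<open>T\<close> with a map \<open>B\<close> giving the set of vertices contained in a node.\<close>

definition nodes_of :: "('n, 'f) pre_digraph \<Rightarrow> ('n \<Rightarrow> 'a set) \<Rightarrow> 'a \<Rightarrow> 'n set" where
  "nodes_of T B v = {t \<in> verts T. v \<in> B t}"

definition tree_model ::
  "('a, 'e) pre_digraph \<Rightarrow> ('n, 'f) pre_digraph \<Rightarrow> ('n \<Rightarrow> 'a set) \<Rightarrow> bool" where
  "tree_model G T B \<longleftrightarrow>
     Digraph.graph T \<and> utree T \<and>
     (\<forall>t \<in> verts T. B t \<subseteq> verts G) \<and>
     (\<forall>v \<in> verts G. utree (T \<restriction> nodes_of T B v)) \<and>
     (\<forall>v \<in> verts G. \<forall>w \<in> verts G. v \<noteq> w \<longrightarrow>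
        (v \<rightarrow>\<^bsub>G\<^esub> w \<longleftrightarrow> (\<exists>t \<in> verts T. v \<in> B t \<and> w \<in> B t)))"

definition rooted_tree_model ::
  "('a, 'e) pre_digraph \<Rightarrow> ('n, 'f) pre_digraph \<Rightarrow> ('n \<Rightarrow> 'a set) \<Rightarrow> 'n \<Rightarrow> bool" where
  "rooted_tree_model G T B R \<longleftrightarrow> tree_model G T B \<and> R \<in> verts T"

definition shortest_path :: "('n, 'f) pre_digraph \<Rightarrow> 'n \<Rightarrow> 'n list \<Rightarrow> 'n \<Rightarrow> bool" where
  "shortest_path T s p t \<longleftrightarrow>
     vpath p T \<and> hd p = s \<and> last p = t \<and>
     (\<forall>q. vpath q T \<and> hd q = s \<and> last q = t \<longrightarrow> vwalk_length p \<le> vwalk_length q)"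

definition rooted_good_pair ::
  "('a, 'e) pre_digraph \<Rightarrow> ('n, 'f) pre_digraph \<Rightarrow> ('n \<Rightarrow> 'a set) \<Rightarrow> 'n \<Rightarrow> 'a \<Rightarrow> 'a \<Rightarrow> bool" where
  "rooted_good_pair G T B R x y \<longleftrightarrow> good_pair G x y \<and>
     (\<forall>s \<in> nodes_of T B x. \<forall>p. shortest_path T s p R \<longrightarrow> set p \<inter> nodes_of T B y \<noteq> {})"

end

theory Submission
  imports Defs "HOL-Homology.Homology"
begin

text \<open>
  Suppose that \<open>W\<close> is an independent dominating set and that each \<open>w \<in> W\<close> has a neighbour \<open>\<phi> w\<close>
  such that the edges \<open>{w, \<phi> w}\<close> form an induced matching. The independent sets inside the matching
  form the boundary of a cross-polytope, a sphere, and sending every vertex outside \<open>W\<close> to the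
  partner of a neighbour in \<open>W\<close> retracts the independence complex onto it; so the complex is
  not contractible. It remains to construct \<open>W\<close> and \<open>\<phi>\<close> whenever a connected graph with at least
  two vertices has a rooted tree model without rooted good pairs. For the induction to work, some
  vertices are allowed to be doubled, that is, replaced by two adjacent twins; a doubled vertex can
  be matched with its own twin and is never the first component of a good pair.
\<close>

section \<open>Matched dominating sets\<close>

locale sgraph =
  fixes E :: "'a \<Rightarrow> 'a \<Rightarrow> bool"
  assumes adj_sym: "E u v \<Longrightarrow> E v u"
    and adj_irrefl: "\<not> E v v"
begin

definition cnb :: "'a \<Rightarrow> 'a set" where
  "cnb v = insert v {u. E v u}"

lemma cnb_self [simp]: "v \<in> cnb v"
  by (simp add: cnb_def)

lemma cnb_sym: "u \<in> cnb v \<longleftrightarrow> v \<in> cnb u"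
  by (auto simp: cnb_def intro: adj_sym)

definition simplicial :: "'a set \<Rightarrow> 'a \<Rightarrow> bool" where
  "simplicial U x \<longleftrightarrow> x \<in> U \<and> (\<forall>u \<in> U \<inter> cnb x. U \<inter> cnb x \<subseteq> cnb u)"

lemma simplicial_subset: "simplicial U x \<Longrightarrow> U' \<subseteq> U \<Longrightarrow> x \<in> U' \<Longrightarrow> simplicial U' x"
  unfolding simplicial_def by blast

text \<open>
  The vertices in \<open>M\<close> are to be thought of as doubled: such a vertex stands for two adjacent
  vertices with the same closed neighbourhood, and \<open>\<phi> w = w\<close> means that \<open>w\<close> is matched with
  its copy.
\<close>

definition matched_dominating ::
  "'a set \<Rightarrow> 'a set \<Rightarrow> 'a set \<Rightarrow> ('a \<Rightarrow> 'a) \<Rightarrow> bool" where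
  "matched_dominating U M W \<phi> \<longleftrightarrow>
     W \<subseteq> U \<and> \<phi> ` W \<subseteq> U \<and> U \<subseteq> (\<Union>w \<in> W. cnb w) \<and>
     (\<forall>w \<in> W. E w (\<phi> w) \<or> \<phi> w = w \<and> w \<in> M) \<and>
     (\<forall>w \<in> W. \<forall>w' \<in> W. w \<noteq> w' \<longrightarrow> \<not> E w w' \<and> \<not> E w (\<phi> w') \<and> \<not> E (\<phi> w) (\<phi> w'))"

lemma matched_dominatingI:
  assumes "W \<subseteq> U" "\<And>w. w \<in> W \<Longrightarrow> \<phi> w \<in> U" "\<And>u. u \<in> U \<Longrightarrow> \<exists>w \<in> W. u \<in> cnb w"
    and "\<And>w. w \<in> W \<Longrightarrow> E w (\<phi> w) \<or> \<phi> w = w \<and> w \<in> M"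
    and "\<And>v w. v \<in> W \<Longrightarrow> w \<in> W \<Longrightarrow> v \<noteq> w \<Longrightarrow> \<not> E v w \<and> \<not> E v (\<phi> w) \<and> \<not> E (\<phi> v) (\<phi> w)"
  shows "matched_dominating U M W \<phi>"
  unfolding matched_dominating_def
proof (intro conjI)
  show "\<phi> ` W \<subseteq> U" using assms(2) by (rule image_subsetI)
  show "U \<subseteq> (\<Union>w \<in> W. cnb w)" using assms(3) by (simp add: subset_iff)
qed (simp_all add: assms(1,4,5))

lemma matched_dominatingD:
  assumes "matched_dominating U M W \<phi>"
  shows "W \<subseteq> U" "\<And>w. w \<in> W \<Longrightarrow> \<phi> w \<in> U" "\<And>u. u \<in> U \<Longrightarrow> \<exists>w \<in> W. u \<in> cnb w"
    and "\<And>w. w \<in> W \<Longrightarrow> E w (\<phi> w) \<or> \<phi> w = w \<and> w \<in> M"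
    and "\<And>v w. v \<in> W \<Longrightarrow> w \<in> W \<Longrightarrow> v \<noteq> w \<Longrightarrow> \<not> E v w \<and> \<not> E v (\<phi> w) \<and> \<not> E (\<phi> v) (\<phi> w)"
  using assms by (simp_all add: matched_dominating_def subset_iff)

definition matchable :: "'a set \<Rightarrow> 'a set \<Rightarrow> bool" where
  "matchable U M \<longleftrightarrow> (\<exists>W \<phi>. matched_dominating U M W \<phi>)"

lemma matchable_empty: "matchable {} M"
  unfolding matchable_def by (intro exI[of _ "{}"] exI matched_dominatingI) simp_all

lemma matchable_marks: "matchable U M \<Longrightarrow> M \<inter> U \<subseteq> M' \<Longrightarrow> matchable U M'"
proof -
  assume "matchable U M" and M: "M \<inter> U \<subseteq> M'"
  then obtain W \<phi> where W: "matched_dominating U M W \<phi>" unfolding matchable_def by blast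
  have "matched_dominating U M' W \<phi>"
    using matched_dominatingD[OF W] M by (intro matched_dominatingI) (simp_all, blast)
  then show ?thesis unfolding matchable_def by blast
qed

text \<open>Coincidences between different pairs are excluded too: a shared vertex would turn an
  edge within one pair into a forbidden edge, or force \<open>v = w\<close>.\<close>

lemma matched_dominating_outside:
  assumes "matched_dominating U M W \<phi>" "w \<in> W" "v \<in> W" "v \<noteq> w"
  shows "v \<notin> cnb w" "\<phi> v \<notin> cnb w" "v \<notin> cnb (\<phi> w)" "\<phi> v \<notin> cnb (\<phi> w)"
proof -
  note D = matched_dominatingD(4,5)[OF assms(1)]
  have *: "\<not> E w v" "\<not> E v w" "\<not> E w (\<phi> v)" "\<not> E v (\<phi> w)" "\<not> E (\<phi> w) (\<phi> v)"
    "E w (\<phi> w) \<or> \<phi> w = w" "E v (\<phi> v) \<or> \<phi> v = v"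
    using D(1)[OF assms(2)] D(1)[OF assms(3)] D(2)[OF assms(2,3)] D(2)[OF assms(3,2)] assms(4)
    by auto
  show "v \<notin> cnb w" "\<phi> v \<notin> cnb w" "v \<notin> cnb (\<phi> w)" "\<phi> v \<notin> cnb (\<phi> w)"
    using * assms(4) by (auto simp: cnb_def dest: adj_sym)
qed

text \<open>What is left after deleting \<open>cnb w\<close> is nonadjacent to \<open>w\<close> and,
  by \<open>sub\<close>, to \<open>p\<close>, so the pair \<open>w\<close>, \<open>p\<close> can be
  added.\<close>

lemma matchable_insert:
  assumes "matchable (U - cnb w) M" "w \<in> U" "p \<in> U" "E w p \<or> p = w \<and> w \<in> M"
    and sub: "U \<inter> cnb p \<subseteq> cnb w"
  shows "matchable U M"
proof -
  obtain W \<phi> where W: "matched_dominating (U - cnb w) M W \<phi>"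
    using assms(1) unfolding matchable_def by blast
  have out: "v \<in> U - cnb w" "\<phi> v \<in> U - cnb w" if "v \<in> W" for v
    using matched_dominatingD(1,2)[OF W] that by auto
  have far: "\<not> E w v" "\<not> E v w" "\<not> E p v" "\<not> E v p" "v \<noteq> w" if "v \<in> U - cnb w" for v
    using that sub by (auto simp: cnb_def dest: adj_sym)
  have "matched_dominating U M (insert w W) (\<phi>(w := p))"
  proof (rule matched_dominatingI)
    show "insert w W \<subseteq> U" using matched_dominatingD(1)[OF W] assms(2) by blast
    show "(\<phi>(w := p)) v \<in> U" if "v \<in> insert w W" for v using out that assms(3) by auto
    show "\<exists>v \<in> insert w W. u \<in> cnb v" if "u \<in> U" for u
      using matched_dominatingD(3)[OF W, of u] that by blast
    show "E v ((\<phi>(w := p)) v) \<or> (\<phi>(w := p)) v = v \<and> v \<in> M" if "v \<in> insert w W" for v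
      using matched_dominatingD(4)[OF W, of v] that assms(4) by auto
    fix u v assume uv: "u \<in> insert w W" "v \<in> insert w W" "u \<noteq> v"
    show "\<not> E u v \<and> \<not> E u ((\<phi>(w := p)) v) \<and> \<not> E ((\<phi>(w := p)) u) ((\<phi>(w := p)) v)"
      using uv matched_dominatingD(5)[OF W, of u v] out[of u] out[of v] far by auto
  qed
  then show ?thesis unfolding matchable_def by blast
qed

text \<open>Domination survives because every vertex dominated by \<open>w\<close> lies in
  \<open>cnb p\<close> and is deleted; the other pairs avoid \<open>cnb p\<close>.\<close>

lemma matched_dominating_remove:
  assumes W: "matched_dominating U M W \<phi>" "w \<in> W" and p: "p = w \<or> p = \<phi> w"
    and sub: "U \<inter> cnb w \<subseteq> cnb p"
  shows "matched_dominating (U - cnb p) M (W - {w}) \<phi>"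
proof -
  have out: "v \<notin> cnb p" "\<phi> v \<notin> cnb p" if "v \<in> W - {w}" for v
    using matched_dominating_outside[OF W, of v] that p by auto
  show ?thesis
  proof (rule matched_dominatingI)
    show "W - {w} \<subseteq> U - cnb p" using matched_dominatingD(1)[OF W(1)] out by blast
    show "\<phi> v \<in> U - cnb p" if "v \<in> W - {w}" for v
      using matched_dominatingD(2)[OF W(1), of v] out that by blast
    show "\<exists>v \<in> W - {w}. u \<in> cnb v" if u: "u \<in> U - cnb p" for u
    proof -
      obtain v where "v \<in> W" "u \<in> cnb v" using matched_dominatingD(3)[OF W(1), of u] u by blast
      moreover have "v \<noteq> w" using u sub calculation(2) by blast
      ultimately show ?thesis by blast
    qed
  qed (simp_all add: matched_dominatingD(4,5)[OF W(1)])
qed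

text \<open>If \<open>x\<close> is in \<open>W\<close>, its partner plays the role of
  \<open>w\<close>; otherwise \<open>w\<close> is a vertex of \<open>W\<close> dominating
  \<open>x\<close>. Conversely, \<open>w\<close> is added with partner \<open>x\<close>, where
  \<open>w = x\<close> means that \<open>x\<close> is matched with its copy.\<close>

lemma matchable_simplicial_iff:
  assumes x: "simplicial U x"
  shows "matchable U M \<longleftrightarrow> (\<exists>w \<in> U \<inter> cnb x. (w = x \<longrightarrow> x \<in> M) \<and> matchable (U - cnb w) M)"
    (is "_ \<longleftrightarrow> ?R")
proof
  assume "matchable U M"
  then obtain W \<phi> where W: "matched_dominating U M W \<phi>" unfolding matchable_def by blast
  have xU: "x \<in> U" and cl: "\<And>u. u \<in> U \<inter> cnb x \<Longrightarrow> U \<inter> cnb x \<subseteq> cnb u"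
    using x unfolding simplicial_def by auto
  show ?R
  proof (cases "x \<in> W")
    case True
    have \<phi>: "E x (\<phi> x) \<or> \<phi> x = x \<and> x \<in> M" "\<phi> x \<in> U"
      using matched_dominatingD(2,4)[OF W True] by auto
    then have "\<phi> x \<in> U \<inter> cnb x" by (auto simp: cnb_def)
    moreover have "matchable (U - cnb (\<phi> x)) M"
      using matched_dominating_remove[OF W True, of "\<phi> x"] cl[OF calculation]
      unfolding matchable_def by blast
    moreover have "\<phi> x = x \<longrightarrow> x \<in> M" using \<phi> adj_irrefl by auto
    ultimately show ?thesis by blast
  next
    case False
    obtain w where w: "w \<in> W" "x \<in> cnb w" using matched_dominatingD(3)[OF W xU] by blast
    then have "w \<in> U \<inter> cnb x" using matched_dominatingD(1)[OF W] cnb_sym by blast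
    moreover have "matchable (U - cnb w) M"
      using matched_dominating_remove[OF W w(1), of w] unfolding matchable_def by blast
    moreover have "w \<noteq> x" using False w by blast
    ultimately show ?thesis by blast
  qed
next
  assume ?R
  then obtain w where w: "w \<in> U \<inter> cnb x" "w = x \<longrightarrow> x \<in> M" "matchable (U - cnb w) M" by blast
  have "E w x \<or> x = w \<and> w \<in> M" using w adj_sym by (auto simp: cnb_def)
  moreover have "x \<in> U" "U \<inter> cnb x \<subseteq> cnb w"
    using x w(1) unfolding simplicial_def by auto
  ultimately show "matchable U M"
    using matchable_insert[OF w(3), of x] w(1) by blast
qed

lemma matchable_unmark_clique:
  assumes "matchable U (M \<union> K)" and clique: "\<And>v. v \<in> K \<Longrightarrow> K \<subseteq> cnb v"
  shows "matchable U M \<or> (\<exists>v \<in> K \<inter> U. matchable (U - cnb v) M)"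
proof -
  obtain W \<phi> where W: "matched_dominating U (M \<union> K) W \<phi>"
    using assms(1) unfolding matchable_def by blast
  show ?thesis
  proof (cases "W \<inter> K = {}")
    case True
    then have "matched_dominating U M W \<phi>"
      using matched_dominatingD[OF W] by (intro matched_dominatingI) (simp_all, blast)
    then show ?thesis unfolding matchable_def by blast
  next
    case False
    then obtain v where v: "v \<in> W" "v \<in> K" by blast
    have "matchable (U - cnb v) (M \<union> K)"
      using matched_dominating_remove[OF W v(1), of v] unfolding matchable_def by blast
    then have "matchable (U - cnb v) M" using clique[OF v(2)] by (blast intro: matchable_marks)
    moreover have "v \<in> U" using matched_dominatingD(1)[OF W] v by blast
    ultimately show ?thesis using v by blast
  qed
qed

lemma matchable_Un:
  assumes "matchable A M" "matchable B M" and sep: "\<And>a b. a \<in> A \<Longrightarrow> b \<in> B \<Longrightarrow> b \<notin> cnb a"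
  shows "matchable (A \<union> B) M"
proof -
  obtain W \<phi> where W: "matched_dominating A M W \<phi>" using assms(1) unfolding matchable_def by blast
  obtain X \<psi> where X: "matched_dominating B M X \<psi>" using assms(2) unfolding matchable_def by blast
  define \<theta> where "\<theta> v = (if v \<in> A then \<phi> v else \<psi> v)" for v
  have far: "\<not> E a b" "\<not> E b a" "a \<noteq> b" if "a \<in> A" "b \<in> B" for a b
    using sep[OF that] adj_sym unfolding cnb_def by auto
  note W' = matched_dominatingD[OF W] and X' = matched_dominatingD[OF X]
  have \<theta>W: "\<theta> w = \<phi> w" if "w \<in> W" for w using that W'(1) by (auto simp: \<theta>_def)
  have \<theta>X: "\<theta> w = \<psi> w" if "w \<in> X" for w using that X'(1) far(3)[of w w] by (auto simp: \<theta>_def)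
  have "matched_dominating (A \<union> B) M (W \<union> X) \<theta>"
  proof (rule matched_dominatingI)
    show "W \<union> X \<subseteq> A \<union> B" using W'(1) X'(1) by blast
    show "\<theta> w \<in> A \<union> B" if "w \<in> W \<union> X" for w using that W'(2) X'(2) \<theta>W \<theta>X by auto
    show "\<exists>w \<in> W \<union> X. u \<in> cnb w" if "u \<in> A \<union> B" for u using that W'(3) X'(3) by blast
    show "E w (\<theta> w) \<or> \<theta> w = w \<and> w \<in> M" if "w \<in> W \<union> X" for w
      using that W'(4)[of w] X'(4)[of w] \<theta>W \<theta>X by auto
    fix u v assume uv: "u \<in> W \<union> X" "v \<in> W \<union> X" "u \<noteq> v"
    have "w \<in> W \<Longrightarrow> w \<in> A \<and> \<phi> w \<in> A" "w \<in> X \<Longrightarrow> w \<in> B \<and> \<psi> w \<in> B" for w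
      using W'(1,2) X'(1,2) by auto
    then show "\<not> E u v \<and> \<not> E u (\<theta> v) \<and> \<not> E (\<theta> u) (\<theta> v)"
      using uv W'(5)[of u v] X'(5)[of u v] \<theta>W \<theta>X far by auto
  qed
  then show ?thesis unfolding matchable_def by blast
qed

text \<open>
  The combinatorial shadow of the exact sequence relating the independence complexes of
  \<open>U - {x}\<close>, \<open>U\<close> and \<open>U - cnb x\<close>.
\<close>

lemma matchable_delete_vertex:
  assumes dirac: "\<And>U x. U \<subseteq> V \<Longrightarrow> x \<in> U \<Longrightarrow> \<not> U \<subseteq> cnb x \<Longrightarrow> \<exists>y \<in> U - cnb x. simplicial U y"
    and "finite U" "U \<subseteq> V" "x \<in> U" "matchable (U - {x}) M"
  shows "matchable U M \<or> matchable (U - cnb x) M"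
  using assms(2-)
proof (induction "card U" arbitrary: U rule: less_induct)
  case less
  show ?case
  proof (cases "U \<subseteq> cnb x")
    case True
    then have "U - cnb x = {}" by blast
    then have "matchable (U - cnb x) M" by (simp only: matchable_empty)
    then show ?thesis ..
  next
    case False
    then obtain y where y: "y \<in> U - cnb x" "simplicial U y"
      using dirac less.prems by blast
    \<comment> \<open>Lying outside \<open>cnb x\<close>, the vertex \<open>y\<close> is simplicial
      in all three sets, so the recursion can be run on them in parallel with the same
      \<open>w\<close>.\<close>
    have "simplicial (U - {x}) y" "simplicial (U - cnb x) y"
      using y by (auto intro: simplicial_subset[OF y(2)])
    note rec = matchable_simplicial_iff[OF this(1)] matchable_simplicial_iff[OF y(2)]
      matchable_simplicial_iff[OF this(2)]
    obtain w where w: "w \<in> (U - {x}) \<inter> cnb y" "w = y \<longrightarrow> y \<in> M" "matchable (U - {x} - cnb w) M"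
      using less.prems(4) rec(1) by blast
    have U: ?thesis if "matchable (U - cnb w) M" using that w rec(2) by blast
    show ?thesis
    proof (cases "x \<in> cnb w")
      case True
      then have "U - {x} - cnb w = U - cnb w" by blast
      then show ?thesis using U w by simp
    next
      case x: False
      have "U - cnb w \<subset> U" using w cnb_self[of w] by blast
      then have "card (U - cnb w) < card U" using less.prems(1) psubset_card_mono by blast
      moreover have "U - {x} - cnb w = U - cnb w - {x}" by blast
      ultimately have "matchable (U - cnb w) M \<or> matchable (U - cnb w - cnb x) M"
        using less.hyps[of "U - cnb w"] less.prems x w(3) by auto
      then show ?thesis
      proof
        assume "matchable (U - cnb w - cnb x) M"
        moreover have "U - cnb w - cnb x = U - cnb x - cnb w" by blast
        moreover have "w \<in> (U - cnb x) \<inter> cnb y" using w x cnb_sym by blast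
        ultimately show ?thesis using rec(3) w(2) by auto
      qed (rule U)
    qed
  qed
qed

end

section \<open>Subtrees of a rooted tree\<close>

text \<open>The facts about a rooted tree model that drive the induction. Here \<open>le a b\<close>
  is to be read as \<open>b\<close> lying on the way from \<open>a\<close> to the root, and
  \<open>t v\<close> is the node of \<open>N v\<close> nearest the root.\<close>

locale tree_order = sgraph E
  for E :: "'a \<Rightarrow> 'a \<Rightarrow> bool" +
  fixes V :: "'a set" and N :: "'a \<Rightarrow> 'n set" and t :: "'a \<Rightarrow> 'n" and le :: "'n \<Rightarrow> 'n \<Rightarrow> bool"
  assumes le_trans: "le a b \<Longrightarrow> le b c \<Longrightarrow> le a c"
    and le_antisym: "le a b \<Longrightarrow> le b a \<Longrightarrow> a = b"
    and le_chain: "le a b \<Longrightarrow> le a c \<Longrightarrow> le b c \<or> le c b"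
    and top_in: "v \<in> V \<Longrightarrow> t v \<in> N v"
    and le_top: "v \<in> V \<Longrightarrow> s \<in> N v \<Longrightarrow> le s (t v)"
    and up_convex: "v \<in> V \<Longrightarrow> s \<in> N v \<Longrightarrow> le s a \<Longrightarrow> le a (t v) \<Longrightarrow> a \<in> N v"
    and adj_iff: "u \<in> V \<Longrightarrow> v \<in> V \<Longrightarrow> u \<noteq> v \<Longrightarrow> E u v \<longleftrightarrow> N u \<inter> N v \<noteq> {}"
begin

lemma cnbI: "u \<in> V \<Longrightarrow> v \<in> V \<Longrightarrow> s \<in> N u \<Longrightarrow> s \<in> N v \<Longrightarrow> u \<in> cnb v"
  using adj_iff[of v u] by (auto simp: cnb_def)

lemma cnbE:
  assumes "u \<in> cnb v" "u \<in> V" "v \<in> V"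
  obtains s where "s \<in> N u" "s \<in> N v"
  using assms adj_iff[of v u] top_in[of v] unfolding cnb_def by blast

lemma tops_comparable:
  "u \<in> cnb v \<Longrightarrow> u \<in> V \<Longrightarrow> v \<in> V \<Longrightarrow> le (t u) (t v) \<or> le (t v) (t u)"
  by (metis cnbE le_chain le_top)

lemma contains_between:
  "u \<in> cnb v \<Longrightarrow> u \<in> V \<Longrightarrow> v \<in> V \<Longrightarrow> le (t v) a \<Longrightarrow> le a (t u) \<Longrightarrow> a \<in> N u"
  by (metis cnbE up_convex le_trans le_top)

lemma minimal_top:
  assumes "finite U" "U \<noteq> {}" "U \<subseteq> V"
  obtains x where "x \<in> U" "\<And>u. u \<in> U \<Longrightarrow> le (t u) (t x) \<Longrightarrow> t u = t x"
proof -
  define R where "R = (\<lambda>a b. le a b \<and> a \<noteq> b)"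
  have "asymp_on (t ` U) R" "transp_on (t ` U) R"
    unfolding R_def by (auto simp: asymp_on_def transp_on_def dest: le_antisym intro: le_trans)
  from Finite_Set.bex_min_element[OF _ this] assms obtain m
    where "m \<in> t ` U" "\<And>b. b \<in> t ` U \<Longrightarrow> b \<noteq> m \<Longrightarrow> \<not> R b m"
    by (metis finite_imageI image_is_empty)
  then show thesis using that unfolding R_def by blast
qed

lemma simplicialI:
  assumes "U \<subseteq> V" "x \<in> U" "\<And>u. u \<in> U \<Longrightarrow> u \<in> cnb x \<Longrightarrow> a \<in> N u"
  shows "simplicial U x"
  unfolding simplicial_def using assms cnbI by blast

text \<open>Dirac's theorem in the form required by \<open>matchable_delete_vertex\<close>, with
  \<open>t x\<close> above all other tops. A nonneighbour \<open>y\<close> of \<open>x\<close> with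
  lowest top works: all its neighbours in \<open>U\<close> contain \<open>t y\<close>.\<close>

lemma exists_simplicial_nonneighbour:
  assumes "finite U" "U \<subseteq> V" "x \<in> U" "\<not> U \<subseteq> cnb x" and root: "\<And>v. v \<in> V \<Longrightarrow> le (t v) (t x)"
  shows "\<exists>y \<in> U - cnb x. simplicial U y"
proof -
  obtain y where y: "y \<in> U - cnb x" "\<And>u. u \<in> U - cnb x \<Longrightarrow> le (t u) (t y) \<Longrightarrow> t u = t y"
    using minimal_top[of "U - cnb x"] assms(1-4) by blast
  have V: "x \<in> V" "y \<in> V" using y assms by auto
  have "simplicial U y"
  proof (rule simplicialI[OF assms(2)])
    fix u assume u: "u \<in> U" "u \<in> cnb y"
    then have uV: "u \<in> V" using assms by blast
    have "le (t y) (t u)"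
    proof (cases "u \<in> cnb x")
      case True
      show ?thesis
      proof (rule ccontr)
        assume "\<not> le (t y) (t u)"
        then have "le (t u) (t y)" using tops_comparable[OF u(2) uV V(2)] by blast
        \<comment> \<open>As \<open>u\<close> lies in \<open>cnb x\<close> and has its top below
          \<open>t y\<close>, the nodes of \<open>x\<close> reach from below \<open>t y\<close> up
          to \<open>t x\<close>.\<close>
        then have "t y \<in> N x"
          using contains_between[of x u "t y"] True cnb_sym uV V root by blast
        then show False using cnbI[OF V(2,1) top_in[OF V(2)]] y by blast
      qed
    next
      case False
      then show ?thesis using y(2)[of u] u tops_comparable[OF u(2) uV V(2)]
        by (metis DiffI)
    qed
    moreover have "le (t y) (t y)" using V top_in le_top by blast
    ultimately show "t y \<in> N u" using contains_between[OF u(2) uV V(2)] by blast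
  qed (use y in blast)
  then show ?thesis using y by blast
qed

text \<open>The absence of rooted good pairs with unmarked first vertex in the subgraph on
  \<open>U\<close>, and of unmarked isolated vertices. The relation \<open>le (t y) (t z)\<close>
  makes every way from a node of \<open>y\<close> to the root pass through
  \<open>t z\<close>.\<close>

definition unpaired :: "'a set \<Rightarrow> 'a set \<Rightarrow> bool" where
  "unpaired U M \<longleftrightarrow> (\<forall>y \<in> U - M. (\<exists>v \<in> U. E y v) \<and>
     (\<forall>z \<in> U. z \<noteq> y \<longrightarrow> le (t y) (t z) \<longrightarrow> (\<exists>v \<in> U. E y v \<and> \<not> E z v)))"

text \<open>Unmarked vertices of \<open>U'\<close> keep all their neighbours, so the old witnesses
  \<open>v\<close> survive.\<close>

lemma unpaired_cong:
  assumes "unpaired U M" "U' \<subseteq> U" and M': "\<And>y. y \<in> U' \<Longrightarrow> y \<notin> M' \<Longrightarrow> y \<notin> M"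
    and nb: "\<And>y v. y \<in> U' \<Longrightarrow> y \<notin> M' \<Longrightarrow> v \<in> U \<Longrightarrow> E y v \<Longrightarrow> v \<in> U'"
  shows "unpaired U' M'"
  unfolding unpaired_def
proof (intro ballI conjI impI)
  fix y assume y: "y \<in> U' - M'"
  then have "y \<in> U - M" using assms by blast
  then have *: "\<exists>v \<in> U. E y v" "\<And>z. z \<in> U \<Longrightarrow> z \<noteq> y \<Longrightarrow> le (t y) (t z) \<Longrightarrow> \<exists>v \<in> U. E y v \<and> \<not> E z v"
    using assms(1) unfolding unpaired_def by blast+
  show "\<exists>v \<in> U'. E y v" using * nb y by blast
  fix z assume "z \<in> U'" "z \<noteq> y" "le (t y) (t z)"
  then show "\<exists>v \<in> U'. E y v \<and> \<not> E z v" using *(2)[of z] nb y assms(2) by blast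
qed

lemma neighbours_contain_top:
  assumes "U \<subseteq> V" "x \<in> U" and min: "\<And>u. u \<in> U \<Longrightarrow> le (t u) (t x) \<Longrightarrow> t u = t x"
    and u: "u \<in> U" "u \<in> cnb x"
  shows "t x \<in> N u" "le (t x) (t u)"
proof -
  have V: "u \<in> V" "x \<in> V" using assms by auto
  show "le (t x) (t u)" using tops_comparable[OF u(2) V] min[OF u(1)] by metis
  moreover have "le (t x) (t x)" using V top_in le_top by blast
  ultimately show "t x \<in> N u" using contains_between[OF u(2) V] by blast
qed

text \<open>
  The induction takes a vertex \<open>x\<close> with lowest top. If \<open>x\<close> is doubled, delete it and double its
  neighbours. Otherwise let \<open>a\<close> be the lowest top among the neighbours of \<open>x\<close>. Since there are no
  good pairs, the bag of \<open>a\<close> consists of neighbours of \<open>x\<close> (and perhaps \<open>x\<close>), so it separates the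
  vertices \<open>B\<close> strictly below \<open>a\<close> from the remaining ones \<open>A\<close>. After removing the closed
  neighbourhood of a suitable neighbour of \<open>x\<close>, both sides are matchable.
\<close>

theorem matchable_if_unpaired:
  assumes dirac: "\<And>U x. U \<subseteq> V \<Longrightarrow> x \<in> U \<Longrightarrow> \<not> U \<subseteq> cnb x \<Longrightarrow> \<exists>y \<in> U - cnb x. simplicial U y"
    and "finite U" "U \<subseteq> V" "unpaired U M"
  shows "matchable U M"
  using assms(2-)
proof (induction "card U" arbitrary: U M rule: less_induct)
  case less
  note fin = less.prems(1) and UV = less.prems(2) and unp = less.prems(3)
  have IH: "matchable U' M'" if "U' \<subseteq> U" "x \<in> U" "x \<notin> U'" "unpaired U' M'" for U' M' x
  proof -
    have "U' \<subset> U" using that by blast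
    then show ?thesis
      using less.hyps[of U' M'] psubset_card_mono[OF fin] finite_subset[OF that(1) fin] that(1,4) UV
      by blast
  qed
  show ?case
  proof (cases "U = {}")
    case True
    then show ?thesis by (simp add: matchable_empty)
  next
    case False
    then obtain x where x: "x \<in> U" and min: "\<And>u. u \<in> U \<Longrightarrow> le (t u) (t x) \<Longrightarrow> t u = t x"
      using minimal_top fin UV by blast
    note nbx = neighbours_contain_top[OF UV x min]
    have sx: "simplicial U x" using simplicialI[OF UV x] nbx by blast
    note rec = matchable_simplicial_iff[OF sx]
    define K where "K = {v \<in> U. E x v}"
    have K: "K = U \<inter> cnb x - {x}" unfolding K_def cnb_def using adj_irrefl by blast
    have clique: "K \<subseteq> cnb v" if "v \<in> K" for v
      using sx that unfolding simplicial_def K by blast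
    show ?thesis
    proof (cases "x \<in> M")
      case True
      \<comment> \<open>Only the neighbours of \<open>x\<close> lose a neighbour by its deletion,
        and these are now marked.\<close>
      have "unpaired (U - {x}) (M \<union> K)"
        by (rule unpaired_cong[OF unp]) (use adj_sym in \<open>auto simp: K_def\<close>)
      then have "matchable (U - {x}) (M \<union> K)" using IH[of _ x] x by blast
      from matchable_unmark_clique[OF this clique] show ?thesis
      proof
        assume "matchable (U - {x}) M"
        \<comment> \<open>If \<open>U - cnb x\<close> is matchable, the recursion matches the marked
          \<open>x\<close> with its own copy.\<close>
        from matchable_delete_vertex[OF dirac fin UV x this] show ?thesis
          using rec x True by auto
      next
        assume "\<exists>v \<in> K \<inter> (U - {x}). matchable (U - {x} - cnb v) M"
        then obtain v where v: "v \<in> K" "matchable (U - {x} - cnb v) M" by blast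
        moreover have "U - {x} - cnb v = U - cnb v" using v(1) cnb_sym unfolding K by blast
        ultimately show ?thesis using rec unfolding K by auto
      qed
    next
      case xM: False
      have "K \<noteq> {}" using unp x xM unfolding unpaired_def K_def by blast
      then obtain w where w: "w \<in> K" and minw: "\<And>u. u \<in> K \<Longrightarrow> le (t u) (t w) \<Longrightarrow> t u = t w"
        using minimal_top[of K] fin UV unfolding K
        by (metis finite_Diff finite_Int inf_le1 order_trans Diff_subset)
      define a where "a = t w"
      have KU: "K \<subseteq> U" and KV: "K \<subseteq> V" and xK: "x \<notin> K" unfolding K using UV by auto
      have xa: "le (t x) a" using nbx[of w] w unfolding K a_def by auto
      have Ka: "le a (t v)" "a \<in> N v" if v: "v \<in> K" for v
      proof -
        have "le (t x) (t v)" "t x \<in> N v" using nbx[of v] v unfolding K by auto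
        moreover show "le a (t v)"
          using le_chain[OF xa calculation(1)] minw[OF v] unfolding a_def by metis
        ultimately show "a \<in> N v" using up_convex[of v "t x" a] xa v KV by blast
      qed
      \<comment> \<open>Otherwise \<open>(x, y)\<close> would be a rooted good pair.\<close>
      have bag: "y \<in> insert x K" if y: "y \<in> U" "a \<in> N y" for y
      proof (rule ccontr)
        assume "y \<notin> insert x K"
        then have ny: "y \<noteq> x" "y \<notin> K" by auto
        have "le (t x) (t y)" using xa le_top[of y a] y UV le_trans by blast
        then obtain v where v: "v \<in> U" "E x v" "\<not> E y v"
          using unp x xM y(1) ny(1) unfolding unpaired_def by blast
        then have "v \<in> K" unfolding K_def by blast
        then have "v \<in> cnb y" using cnbI[of v y a] Ka y KV UV by blast
        then show False using v \<open>v \<in> K\<close> ny unfolding cnb_def by auto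
      qed
      have bag_cnb: "y \<in> cnb v" if "y \<in> U" "a \<in> N y" "v \<in> K" for y v
        using cnbI[of y v a] Ka(2)[OF that(3)] that KV UV by blast
      define B where "B = {u \<in> U. le (t u) a \<and> t u \<noteq> a}"
      define A where "A = {u \<in> U. \<not> (le (t u) a \<and> t u \<noteq> a) \<and> a \<notin> N u}"
      have A_up: "\<not> le (t u) a" if "u \<in> A" for u
        using that top_in[of u] UV unfolding A_def by auto
      \<comment> \<open>All nodes of \<open>w\<close> lie below \<open>a\<close>, while no node of a
        vertex of \<open>A\<close> does; hence \<open>w\<close> has no neighbour in
        \<open>A\<close>.\<close>
      have A_nb: "v \<in> A \<union> K \<and> v \<noteq> w" if y: "y \<in> A" and v: "v \<in> U" "v \<in> cnb y" for y v
      proof -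
        have V: "y \<in> V" "v \<in> V" "y \<in> U" and yv: "y \<in> cnb v"
          using y v UV cnb_sym unfolding A_def by blast+
        have nle: "\<not> le (t v) a"
        proof
          assume va: "le (t v) a"
          then have "\<not> le a (t y)"
            using contains_between[OF yv V(1,2) va] y unfolding A_def by blast
          moreover have "le (t y) (t v) \<or> le (t v) (t y)" using tops_comparable[OF yv V(1,2)] .
          ultimately have "le (t y) a" using va le_trans le_chain[of "t v"] by blast
          then show False using A_up[OF y] by blast
        qed
        then have "v \<noteq> w" "v \<noteq> x" using Ka(1)[OF w] xa unfolding a_def by auto
        moreover have "v \<in> A \<or> a \<in> N v" using nle v unfolding A_def by blast
        ultimately show ?thesis using bag[OF v(1)] by blast
      qed
      have B_nb: "v \<in> B \<or> a \<in> N v" if y: "y \<in> B" and v: "v \<in> U" "v \<in> cnb y" for y v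
      proof -
        have V: "y \<in> V" "v \<in> V" and ya: "le (t y) a" using y v UV unfolding B_def by auto
        obtain s where s: "s \<in> N v" "s \<in> N y" using cnbE[OF v(2) V(2,1)] .
        have "le s a" using le_trans[OF le_top[OF V(1) s(2)] ya] .
        then have "le (t v) a \<or> le a (t v)" using le_chain le_top[OF V(2) s(1)] by blast
        then show ?thesis
          using contains_between[OF v(2) V(2,1) ya] v(1) top_in[OF V(2)] unfolding B_def by auto
      qed
      have B_match: "matchable (B - cnb w') M" if w': "w' \<in> K" for w'
      proof -
        have w'V: "w' \<in> V" "w' \<in> U" "le a (t w')" using w' KV KU Ka by auto
        have nb: "v \<in> B - cnb w' \<or> E w' v" if "y \<in> B - cnb w'" "v \<in> U" "E y v" for y v
        proof -
          have "v \<in> cnb w'" if "v \<notin> B"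
            using B_nb[of y v] bag_cnb[OF \<open>v \<in> U\<close> _ w'] \<open>y \<in> B - cnb w'\<close> \<open>v \<in> U\<close> \<open>E y v\<close> that
            unfolding cnb_def by blast
          moreover have "v \<noteq> w'" using that adj_sym[of y v] unfolding cnb_def by blast
          ultimately show ?thesis using \<open>v \<in> U\<close> unfolding cnb_def by blast
        qed
        have "unpaired (B - cnb w') M"
          unfolding unpaired_def
        proof (intro ballI conjI impI)
          fix y assume y: "y \<in> B - cnb w' - M"
          then have yU: "y \<in> U" "y \<in> V" "le (t y) a" "t y \<noteq> a" "y \<noteq> w'" using UV unfolding B_def by auto
          have "le (t y) (t w')" using yU w'V le_trans by blast
          \<comment> \<open>Since \<open>y\<close> and \<open>w'\<close> do not form a good pair,
            \<open>y\<close> has a neighbour outside \<open>cnb w'\<close>.\<close>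
          then obtain v where "v \<in> U" "E y v" "\<not> E w' v"
            using unp y yU w'V unfolding unpaired_def by (metis DiffD2 DiffI)
          then show "\<exists>v \<in> B - cnb w'. E y v" using nb y by blast
          fix z assume z: "z \<in> B - cnb w'" "z \<noteq> y" "le (t y) (t z)"
          then have zU: "z \<in> U" "z \<in> V" "le (t z) a" using UV unfolding B_def by auto
          obtain v where v: "v \<in> U" "E y v" "\<not> E z v"
            using unp y yU z zU unfolding unpaired_def by blast
          have vV: "v \<in> V" using v UV by blast
          \<comment> \<open>Otherwise \<open>v\<close> is in \<open>cnb w'\<close>. Either
            \<open>v\<close> contains \<open>t z\<close> and is in \<open>cnb z\<close>, or its top
            is below \<open>t z\<close>; then \<open>w'\<close> reaches up through
            \<open>t z\<close> and \<open>z\<close> is in \<open>cnb w'\<close>. Both are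
            excluded.\<close>
          have "v \<in> B - cnb w'"
          proof (rule ccontr)
            assume "v \<notin> B - cnb w'"
            then have vw': "v \<in> cnb w'" using nb[of y v] y v unfolding cnb_def by blast
            have "v \<noteq> z" using vw' z by blast
            then have nvz: "v \<notin> cnb z" using v unfolding cnb_def by blast
            have vy: "v \<in> cnb y" using v unfolding cnb_def by blast
            obtain s where s: "s \<in> N v" "s \<in> N y" using cnbE[OF vy vV yU(2)] .
            have "le s (t z)" using le_trans[OF le_top[OF yU(2) s(2)] z(3)] .
            then consider "le (t v) (t z)" | "le (t z) (t v)" "t z \<in> N v"
              using le_chain[OF _ le_top[OF vV s(1)]] up_convex[OF vV s(1)] by blast
            then show False
            proof cases
              case 1
              have "t z \<in> N w'"
                using contains_between[of w' v "t z"] vw' cnb_sym 1 w'V vV le_trans[OF zU(3)] by blast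
              then show False using cnbI[OF zU(2) w'V(1) top_in[OF zU(2)]] z by blast
            next
              case 2
              then show False using cnbI[OF vV zU(2) _ top_in[OF zU(2)]] nvz by blast
            qed
          qed
          then show "\<exists>v \<in> B - cnb w'. E y v \<and> \<not> E z v" using v by blast
        qed
        moreover have "x \<notin> B - cnb w'" using w' cnb_sym unfolding K by blast
        moreover have "B - cnb w' \<subseteq> U" unfolding B_def by blast
        ultimately show ?thesis using IH[of "B - cnb w'" x] x by simp
      qed
      \<comment> \<open>Induction is applied to \<open>A \<union> K - {w}\<close> with the rest of
        \<open>K\<close> marked. The marks are then removed and \<open>w\<close> is put back; each
        outcome deletes the closed neighbourhood of some vertex of \<open>K\<close>, and thereby all
        of \<open>K\<close>.\<close>
      have "\<exists>w' \<in> K. matchable (A - cnb w') M"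
      proof -
        have AKU: "A \<union> K \<subseteq> U" using KU unfolding A_def by blast
        have xA: "x \<notin> A" using A_up xa by blast
        have wA: "A - cnb w = A" using A_nb KU w cnb_sym by blast
        have drop: "A \<union> K - cnb v = A - cnb v" if "v \<in> K" for v using clique[OF that] by blast
        \<comment> \<open>The unmarked vertices all lie in \<open>A\<close>, and by
          \<open>A_nb\<close> they keep all their neighbours.\<close>
        have "unpaired (A \<union> K - {w}) (M \<union> (K - {w}))"
        proof (rule unpaired_cong[OF unp])
          fix y v assume "y \<in> A \<union> K - {w}" "y \<notin> M \<union> (K - {w})" "v \<in> U" "E y v"
          then show "v \<in> A \<union> K - {w}" using A_nb[of y v] unfolding cnb_def by blast
        qed (use AKU in auto)
        then have "matchable (A \<union> K - {w}) (M \<union> (K - {w}))"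
          by (intro IH[of _ x]) (use AKU x xA xK in auto)
        then have "matchable (A \<union> K - {w}) M \<or>
            (\<exists>v \<in> (K - {w}) \<inter> (A \<union> K - {w}). matchable (A \<union> K - {w} - cnb v) M)"
          by (rule matchable_unmark_clique) (use clique in blast)
        then show ?thesis
        proof
          assume m: "matchable (A \<union> K - {w}) M"
          have "finite (A \<union> K)" "A \<union> K \<subseteq> V" using AKU fin UV finite_subset by blast+
          from matchable_delete_vertex[OF dirac this _ m] w
          have "matchable (A \<union> K) M \<or> matchable (A \<union> K - cnb w) M" by blast
          then show ?thesis
          proof
            assume m: "matchable (A \<union> K) M"
            have nbw: "(A \<union> K) \<inter> cnb w \<subseteq> K" using wA by blast
            \<comment> \<open>The closed neighbourhood of \<open>w\<close> lies in the clique
              \<open>K\<close>, so the recursion at \<open>w\<close> produces a vertex of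
              \<open>K\<close>.\<close>
            have "simplicial (A \<union> K) w"
              using nbw clique w unfolding simplicial_def by blast
            from matchable_simplicial_iff[OF this, of M] m obtain v
              where v: "v \<in> (A \<union> K) \<inter> cnb w" "matchable (A \<union> K - cnb v) M" by blast
            then have "v \<in> K" using nbw by blast
            then show ?thesis using v(2) drop by auto
          qed (use drop[OF w] w in auto)
        next
          assume "\<exists>v \<in> (K - {w}) \<inter> (A \<union> K - {w}). matchable (A \<union> K - {w} - cnb v) M"
          then obtain v where v: "v \<in> K" "matchable (A \<union> K - {w} - cnb v) M" by blast
          moreover have "A \<union> K - {w} - cnb v = A - cnb v" using drop[OF v(1)] clique[OF v(1)] w by blast
          ultimately show ?thesis by auto
        qed
      qed
      then obtain w' where w': "w' \<in> K" "matchable (A - cnb w') M" by blast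
      have "matchable ((B - cnb w') \<union> (A - cnb w')) M"
      proof (rule matchable_Un[OF B_match[OF w'(1)] w'(2)])
        fix b c assume bc: "b \<in> B - cnb w'" "c \<in> A - cnb w'"
        show "c \<notin> cnb b"
          using B_nb[of b c] bc unfolding A_def B_def by blast
      qed
      \<comment> \<open>The vertices of \<open>U\<close> outside \<open>A \<union> B\<close> have
        \<open>a\<close> in their subtree and hence lie in \<open>cnb w'\<close>.\<close>
      moreover have "(B - cnb w') \<union> (A - cnb w') = U - cnb w'"
        using bag_cnb[OF _ _ w'(1)] unfolding A_def B_def by blast
      ultimately show ?thesis using rec w'(1) unfolding K by auto
    qed
  qed
qed

end

section \<open>Tree models\<close>

lemma rtrancl_on_avoid:
  "(s, R) \<in> rtrancl_on X r \<Longrightarrow> (s, R) \<in> rtrancl_on (X - {u}) r \<or> (u, R) \<in> rtrancl_on X r"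
proof (induction rule: converse_rtrancl_on_induct)
  case (step x y)
  then show ?case
    by (cases "x = u") (auto intro: converse_rtrancl_on_into_rtrancl_on)
qed auto

lemma rtrancl_on_last_visit:
  assumes "(p, R) \<in> rtrancl_on X r" "s \<noteq> u"
  shows "(p, R) \<in> rtrancl_on (X - {s, u}) r \<or> (s, R) \<in> rtrancl_on (X - {u}) r
    \<or> (u, R) \<in> rtrancl_on (X - {s}) r"
  using assms(1)
proof (induction rule: converse_rtrancl_on_induct)
  case base
  then show ?case using assms(2) by auto
next
  case (step x y)
  have mono: "(y, R) \<in> rtrancl_on (X - {u}) r" "(y, R) \<in> rtrancl_on (X - {s}) r"
    if "(y, R) \<in> rtrancl_on (X - {s, u}) r"
    using that by (auto elim: rtrancl_on_mono[rotated 2])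
  show ?case
    using step mono assms(2)
    by (cases "x = s"; cases "x = u") (auto intro: converse_rtrancl_on_into_rtrancl_on)
qed

lemma rtrancl_on_first_visit:
  assumes "(s, R) \<in> rtrancl_on X r" "u \<noteq> q"
  shows "(s, R) \<in> rtrancl_on (X - {u, q}) r \<or> (s, u) \<in> rtrancl_on (X - {q}) r
    \<or> (s, q) \<in> rtrancl_on (X - {u}) r"
  using assms(1)
proof (induction rule: converse_rtrancl_on_induct)
  case base
  then show ?case using assms(2) by auto
next
  case (step x y)
  then show ?case
    using assms(2)
    by (cases "x = u"; cases "x = q") (auto intro: converse_rtrancl_on_into_rtrancl_on)
qed

lemma rtrancl_on_last_exit:
  assumes "(s, R) \<in> rtrancl_on X r" "s \<in> N"
  shows "\<exists>m \<in> N. m = R \<or> (\<exists>m'. (m, m') \<in> r \<and> (m', R) \<in> rtrancl_on (X - N) r)" (is ?exit)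
proof -
  have "(s, R) \<in> rtrancl_on (X - N) r \<or> ?exit"
    using assms(1)
  proof (induction rule: converse_rtrancl_on_induct)
    case (step x y)
    then show ?case
      by (cases "x \<in> N") (auto intro: converse_rtrancl_on_into_rtrancl_on)
  qed auto
  then show ?thesis using assms(2) in_rtrancl_on_in_F(1) by fastforce
qed

lemma rtrancl_on_first_entry:
  assumes "(s, m) \<in> rtrancl_on X r" "s \<noteq> m"
  shows "\<exists>n. (s, n) \<in> rtrancl_on (X - {m}) r \<and> (n, m) \<in> r" (is ?entry)
proof -
  have "(s, z) \<in> rtrancl_on (X - {m}) r \<or> ?entry" if "(s, z) \<in> rtrancl_on X r" for z
    using that
  proof (induction rule: rtrancl_on_induct)
    case base
    then show ?case using assms(2) by auto
  next
    case (step y z)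
    then show ?case
      by (cases "z = m") (auto intro: rtrancl_on_into_rtrancl_on)
  qed
  then show ?thesis using in_rtrancl_on_in_F(2) assms(1) by fastforce
qed

lemma vwalk_of_rtrancl_on:
  assumes "(a, b) \<in> rtrancl_on X (arcs_ends G)" "X \<subseteq> verts G"
  shows "\<exists>p. vwalk p G \<and> set p \<subseteq> X \<and> hd p = a \<and> last p = b"
  using assms(1)
proof (induction rule: converse_rtrancl_on_induct)
  case base
  then show ?case using assms(2) by (intro exI[of _ "[b]"]) auto
next
  case (step x y)
  then obtain p where p: "vwalk p G" "set p \<subseteq> X" "hd p = y" "last p = b" by blast
  then have "p \<noteq> []" by (auto simp: vwalk_def)
  then show ?case
    using p step assms(2) by (intro exI[of _ "x # p"]) (auto intro: vwalk_consI)
qed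

lemma rtrancl_on_of_vwalk:
  assumes "vwalk p G"
  shows "set p \<subseteq> X \<Longrightarrow> (hd p, last p) \<in> rtrancl_on X (arcs_ends G)"
  using assms
  by (induction p rule: vwalk_induct) (auto intro: converse_rtrancl_on_into_rtrancl_on)

text \<open>A walk from \<open>n\<close> to \<open>n'\<close> avoiding \<open>m\<close> shortens to
  a path with at least two vertices, which \<open>m\<close> closes up to a cycle.\<close>

lemma no_return_in_acyclic:
  assumes "symmetric G" "\<nexists>c. ucycle G c" "m \<in> verts G" "n \<noteq> n'"
    and "(m, n) \<in> arcs_ends G" "(m, n') \<in> arcs_ends G"
  shows "(n, n') \<notin> rtrancl_on (verts G - {m}) (arcs_ends G)"
proof
  assume "(n, n') \<in> rtrancl_on (verts G - {m}) (arcs_ends G)"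
  then obtain q where q: "vwalk q G" "set q \<subseteq> verts G - {m}" "hd q = n" "last q = n'"
    using vwalk_of_rtrancl_on[of n n' "verts G - {m}" G] by blast
  define p where "p = vwalk_to_vpath q"
  have p: "vwalk p G" "distinct p" "m \<notin> set p" "hd p = n" "last p = n'" "p \<noteq> []"
    using vwalk_to_vpath_vpath[OF q(1)] vwalk_to_vpath_subset[of _ q] q
    by (auto simp: p_def vwalk_to_vpath_hd vwalk_to_vpath_last vpath_def vwalk_def)
  have "length p \<noteq> 1" using p \<open>n \<noteq> n'\<close> by (cases p) auto
  then have "3 \<le> length (m # p)" using p(6) by (cases p; cases "tl p") auto
  moreover have "(n', m) \<in> arcs_ends G"
    using assms(1,6) by (auto simp: symmetric_def dest: symD)
  then have "vwalk ((m # p) @ [hd (m # p)]) G"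
    using p assms(3,5) by (auto simp: vwalk_def vwalk_arcs_append)
  ultimately have "ucycle G (m # p)" using p unfolding ucycle_def by simp
  then show False using assms(2) by blast
qed

text \<open>
  A node \<open>s\<close> lies below \<open>u\<close> if every walk from \<open>s\<close> to the root \<open>R\<close> passes through \<open>u\<close>. With this
  definition the uniqueness of paths in a tree is never needed.
\<close>

definition node_below :: "('n, 'f) pre_digraph \<Rightarrow> 'n \<Rightarrow> 'n \<Rightarrow> 'n \<Rightarrow> bool" where
  "node_below T R s u \<longleftrightarrow> s \<in> verts T \<and> u \<in> verts T \<and>
     (s, R) \<notin> rtrancl_on (verts T - {u}) (arcs_ends T)"

lemma node_below_root: "s \<in> verts T \<Longrightarrow> R \<in> verts T \<Longrightarrow> node_below T R s R"
  unfolding node_below_def using in_rtrancl_on_in_F(2) by fastforce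

text \<open>A walk to the root avoiding \<open>q\<close> would have to visit \<open>u\<close>, and
  its remainder from there would still avoid \<open>q\<close>.\<close>

lemma node_below_trans:
  assumes "node_below T R s u" "node_below T R u q"
  shows "node_below T R s q"
proof -
  have "(s, R) \<notin> rtrancl_on (verts T - {q} - {u}) (arcs_ends T)"
    using assms unfolding node_below_def
    by (meson rtrancl_on_mono Diff_mono Diff_subset order_refl)
  then show ?thesis
    using assms rtrancl_on_avoid[of s R "verts T - {q}" _ u] unfolding node_below_def by blast
qed

lemma reachable_on_if_connected:
  assumes "symmetric G" "Digraph_Component.connected G" "s \<in> verts G" "u \<in> verts G"
  shows "(s, u) \<in> rtrancl_on (verts G) (arcs_ends G)"
proof -
  have "(arcs_ends G)\<^sup>s = arcs_ends G"
    using assms(1) by (auto simp: symcl_def symmetric_def dest: symD)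
  then show ?thesis using assms by (simp add: connected_conv)
qed

text \<open>Cut a walk from \<open>s\<close> to the root at its last visit to \<open>s\<close> or
  \<open>u\<close>: what remains starts at one of them and avoids the other.\<close>

lemma node_below_antisym:
  assumes "symmetric T" "Digraph_Component.connected T" "R \<in> verts T"
    and "node_below T R s u" "node_below T R u s"
  shows "s = u"
proof (rule ccontr)
  assume "s \<noteq> u"
  moreover have "(s, R) \<in> rtrancl_on (verts T) (arcs_ends T)"
    using reachable_on_if_connected[OF assms(1,2) _ assms(3)] assms(4) by (simp add: node_below_def)
  ultimately have "(s, R) \<in> rtrancl_on (verts T - {s, u}) (arcs_ends T)"
    using rtrancl_on_last_visit[of s R "verts T" "arcs_ends T" s u] assms(4,5) by (simp add: node_below_def)
  then show False using in_rtrancl_on_in_F(1) by fastforce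
qed

text \<open>Otherwise \<open>u\<close> reaches the root without \<open>q\<close> and vice versa. A
  walk from \<open>s\<close> to the root, stopped at the first of \<open>u\<close> and
  \<open>q\<close> that it meets, can then be continued so as to avoid the other one.\<close>

lemma node_below_chain:
  assumes "symmetric T" "Digraph_Component.connected T" "R \<in> verts T"
    and "node_below T R s u" "node_below T R s q"
  shows "node_below T R u q \<or> node_below T R q u"
proof (rule ccontr)
  let ?r = "arcs_ends T"
  assume "\<not> ?thesis"
  then have uq: "(u, R) \<in> rtrancl_on (verts T - {q}) ?r" "(q, R) \<in> rtrancl_on (verts T - {u}) ?r"
    using assms unfolding node_below_def by auto
  have "u \<noteq> q" using uq in_rtrancl_on_in_F(1) by fastforce
  moreover have "(s, R) \<in> rtrancl_on (verts T) ?r"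
    using reachable_on_if_connected[OF assms(1,2) _ assms(3)] assms(4) by (simp add: node_below_def)
  moreover have "(s, u) \<notin> rtrancl_on (verts T - {q}) ?r" "(s, q) \<notin> rtrancl_on (verts T - {u}) ?r"
    using rtrancl_on_trans[OF _ uq(1)] rtrancl_on_trans[OF _ uq(2)] assms(4,5)
    by (auto simp: node_below_def)
  ultimately have "(s, R) \<in> rtrancl_on (verts T - {u, q}) ?r"
    using rtrancl_on_first_visit[of s R "verts T" ?r u q] by simp
  then have "(s, R) \<in> rtrancl_on (verts T - {u}) ?r"
    by (auto elim: rtrancl_on_mono[rotated 2])
  then show False using assms unfolding node_below_def by blast
qed

text \<open>The top \<open>m\<close> is where a walk to the root leaves \<open>N\<close> for the
  last time, or the root itself. If some \<open>s\<close> in \<open>N\<close> reached the root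
  without \<open>m\<close>, two neighbours of \<open>m\<close>, the one before it on a walk from
  \<open>s\<close> inside \<open>N\<close> and the one after it on the way out, would be joined by a
  walk avoiding \<open>m\<close>, contrary to acyclicity.\<close>

lemma ex_subtree_top:
  assumes T: "symmetric T" "utree T" "R \<in> verts T"
    and N: "N \<subseteq> verts T" "N \<noteq> {}" "\<And>s u. s \<in> N \<Longrightarrow> u \<in> N \<Longrightarrow> (s, u) \<in> rtrancl_on N (arcs_ends T)"
  shows "\<exists>m \<in> N. \<forall>s \<in> N. node_below T R s m"
proof -
  let ?r = "arcs_ends T"
  have symr: "sym ?r" using T(1) by (simp add: symmetric_def)
  obtain s0 where s0: "s0 \<in> N" using N by blast
  have "(s0, R) \<in> rtrancl_on (verts T) ?r"
    using reachable_on_if_connected[OF T(1) _ _ T(3)] T(2) N(1) s0 unfolding utree_def by auto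
  from rtrancl_on_last_exit[OF this s0] obtain m
    where m: "m \<in> N" "m = R \<or> (\<exists>m'. (m, m') \<in> ?r \<and> (m', R) \<in> rtrancl_on (verts T - N) ?r)"
    by blast
  have "node_below T R s m" if s: "s \<in> N" for s
  proof (rule ccontr)
    assume "\<not> node_below T R s m"
    then have sR: "(s, R) \<in> rtrancl_on (verts T - {m}) ?r"
      using s m N(1) unfolding node_below_def by blast
    have "m \<noteq> R" "s \<noteq> m" using in_rtrancl_on_in_F[OF sR] by auto
    then obtain m' where m': "(m, m') \<in> ?r" "(m', R) \<in> rtrancl_on (verts T - N) ?r" using m by blast
    obtain n where n: "(s, n) \<in> rtrancl_on (N - {m}) ?r" "(n, m) \<in> ?r"
      using rtrancl_on_first_entry[OF N(3)[OF s m(1)] \<open>s \<noteq> m\<close>] by blast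
    have "(s, n) \<in> rtrancl_on (verts T - {m}) ?r"
      using n(1) N(1) by (auto elim: rtrancl_on_mono[rotated 2])
    then have "(n, s) \<in> rtrancl_on (verts T - {m}) ?r"
      using rtrancl_on_sym[OF symr] by (meson symD)
    moreover have "(m', R) \<in> rtrancl_on (verts T - {m}) ?r"
      using m'(2) m(1) by (auto elim: rtrancl_on_mono[rotated 2])
    then have "(R, m') \<in> rtrancl_on (verts T - {m}) ?r"
      using rtrancl_on_sym[OF symr] by (meson symD)
    ultimately have "(n, m') \<in> rtrancl_on (verts T - {m}) ?r"
      using sR rtrancl_on_trans by metis
    moreover have "n \<noteq> m'"
      using in_rtrancl_on_in_F(2)[OF n(1)] in_rtrancl_on_in_F(1)[OF m'(2)] by blast
    moreover have "(m, n) \<in> ?r" using n(2) symr by (meson symD)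
    ultimately show False
      using no_return_in_acyclic[OF T(1) _ _ \<open>n \<noteq> m'\<close> _ m'(1)] T(2) m(1) N(1)
      unfolding utree_def by blast
  qed
  then show ?thesis using m(1) by blast
qed

text \<open>If \<open>u\<close> were outside \<open>N\<close>, the walk within \<open>N\<close> from
  \<open>s\<close> to \<open>m\<close> would avoid it, so \<open>m\<close> would lie below
  \<open>u\<close> as well, forcing \<open>u = m\<close>.\<close>

lemma subtree_up_convex:
  assumes T: "symmetric T" "Digraph_Component.connected T" "R \<in> verts T"
    and N: "N \<subseteq> verts T" "\<And>s u. s \<in> N \<Longrightarrow> u \<in> N \<Longrightarrow> (s, u) \<in> rtrancl_on N (arcs_ends T)"
    and "m \<in> N" "s \<in> N" "node_below T R s u" "node_below T R u m"
  shows "u \<in> N"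
proof (rule ccontr)
  assume u: "u \<notin> N"
  have "(s, m) \<in> rtrancl_on (verts T - {u}) (arcs_ends T)"
    by (rule rtrancl_on_mono[OF _ _ N(2)]) (use assms u in auto)
  from rtrancl_on_trans[OF this] have "node_below T R m u"
    using assms(8,9) by (auto simp: node_below_def)
  then have "u = m" using node_below_antisym[OF T] assms(9) by blast
  then show False using u assms(6) by blast
qed

section \<open>From tree models to the order-theoretic setting\<close>

lemma sgraph_dominates: "Digraph.graph G \<Longrightarrow> sgraph (\<lambda>u v. u \<rightarrow>\<^bsub>G\<^esub> v)"
proof
  assume G: "Digraph.graph G"
  interpret Digraph.graph G by fact
  show "v \<rightarrow>\<^bsub>G\<^esub> u" if "u \<rightarrow>\<^bsub>G\<^esub> v" for u v
    using that sym_arcs by (auto simp: symmetric_def dest: symD)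
  show "\<not> v \<rightarrow>\<^bsub>G\<^esub> v" for v using no_loops by (auto simp: arcs_ends_conv)
qed

lemma tree_order_of_tree_model:
  assumes G: "Digraph.graph G" and model: "tree_model G T B" and R: "R \<in> verts T"
  shows "\<exists>t. tree_order (\<lambda>u v. u \<rightarrow>\<^bsub>G\<^esub> v) (verts G) (nodes_of T B) t (node_below T R)"
proof -
  interpret sgraph "\<lambda>u v. u \<rightarrow>\<^bsub>G\<^esub> v" by (rule sgraph_dominates[OF G])
  have T: "Digraph.graph T" "utree T" using model unfolding tree_model_def by auto
  interpret T: Digraph.graph T by fact
  have symT: "symmetric T" by (rule T.sym_arcs)
  have conT: "Digraph_Component.connected T" using T unfolding utree_def by blast
  let ?N = "nodes_of T B"
  have sub: "?N v \<subseteq> verts T" for v unfolding nodes_of_def by blast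
  have con: "?N v \<noteq> {}" "\<And>s u. s \<in> ?N v \<Longrightarrow> u \<in> ?N v \<Longrightarrow> (s, u) \<in> rtrancl_on (?N v) (arcs_ends T)"
    if v: "v \<in> verts G" for v
  proof -
    have c: "Digraph_Component.connected (T \<restriction> ?N v)"
      using model v unfolding tree_model_def utree_def by blast
    then show "?N v \<noteq> {}" by (simp add: connected_conv)
    have "symmetric (T \<restriction> ?N v)"
      using symT unfolding symmetric_conv by simp metis
    note r = reachable_on_if_connected[OF this c]
    fix s u assume "s \<in> ?N v" "u \<in> ?N v"
    then have "(s, u) \<in> rtrancl_on (?N v) (arcs_ends (T \<restriction> ?N v))" using r by simp
    moreover have "arcs_ends (T \<restriction> ?N v) \<subseteq> arcs_ends T" by (auto simp: arcs_ends_conv)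
    ultimately show "(s, u) \<in> rtrancl_on (?N v) (arcs_ends T)"
      by (rule rtrancl_on_mono[OF _ subset_refl, rotated])
  qed
  have "\<exists>m. v \<in> verts G \<longrightarrow> m \<in> ?N v \<and> (\<forall>s \<in> ?N v. node_below T R s m)" for v
    using ex_subtree_top[OF symT T(2) R sub[of v] con[of v]] by blast
  then obtain t where t: "\<And>v. v \<in> verts G \<Longrightarrow> t v \<in> ?N v"
    "\<And>v s. v \<in> verts G \<Longrightarrow> s \<in> ?N v \<Longrightarrow> node_below T R s (t v)" by metis
  have "tree_order (\<lambda>u v. u \<rightarrow>\<^bsub>G\<^esub> v) (verts G) ?N t (node_below T R)"
  proof
    show "a \<in> ?N v" if "v \<in> verts G" "s \<in> ?N v" "node_below T R s a" "node_below T R a (t v)" for v s a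
      using subtree_up_convex[OF symT conT R sub con(2)[OF that(1)] t(1)[OF that(1)] that(2-4)] .
    show "u \<rightarrow>\<^bsub>G\<^esub> v \<longleftrightarrow> ?N u \<inter> ?N v \<noteq> {}" if "u \<in> verts G" "v \<in> verts G" "u \<noteq> v" for u v
      using model that unfolding tree_model_def nodes_of_def by blast
  qed (fact node_below_trans node_below_antisym[OF symT conT R]
        node_below_chain[OF symT conT R] t)+
  then show ?thesis by blast
qed

theorem matchable_if_no_rooted_good_pair:
  fixes G :: "('a, 'e) pre_digraph"
  assumes G: "Digraph.graph G" "Digraph_Component.connected G" "card (verts G) \<noteq> 1"
    and model: "rooted_tree_model G T B R" and none: "\<nexists>x y. rooted_good_pair G T B R x y"
  shows "sgraph.matchable (\<lambda>u v. u \<rightarrow>\<^bsub>G\<^esub> v) (verts G) {}"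
proof -
  interpret G: Digraph.graph G by fact
  have tm: "tree_model G T B" "R \<in> verts T" using model unfolding rooted_tree_model_def by auto
  obtain t where "tree_order (\<lambda>u v. u \<rightarrow>\<^bsub>G\<^esub> v) (verts G) (nodes_of T B) t (node_below T R)"
    using tree_order_of_tree_model[OF G(1) tm] by blast
  then interpret tree_order "\<lambda>u v. u \<rightarrow>\<^bsub>G\<^esub> v" "verts G" "nodes_of T B" t "node_below T R" .
  have dirac: "\<exists>y \<in> U - cnb x. simplicial U y"
    if U: "U \<subseteq> verts G" "x \<in> U" "\<not> U \<subseteq> cnb x" for U x
  proof -
    have x: "x \<in> verts G" using U by blast
    \<comment> \<open>The same tree is rerooted at a node of \<open>x\<close>, which makes the root
      the top of \<open>x\<close>.\<close>
    obtain R' where R': "R' \<in> nodes_of T B x" using top_in[OF x] by blast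
    then have R'T: "R' \<in> verts T" by (simp add: nodes_of_def)
    obtain t' where "tree_order (\<lambda>u v. u \<rightarrow>\<^bsub>G\<^esub> v) (verts G) (nodes_of T B) t' (node_below T R')"
      using tree_order_of_tree_model[OF G(1) tm(1) R'T] by blast
    then interpret R': tree_order "\<lambda>u v. u \<rightarrow>\<^bsub>G\<^esub> v" "verts G" "nodes_of T B" t' "node_below T R'" .
    have below: "node_below T R' (t' v) R'" if "v \<in> verts G" for v
      using R'.top_in[OF that] R'T node_below_root by (auto simp: nodes_of_def)
    have "t' x = R'" using R'.le_antisym[OF below[OF x] R'.le_top[OF x R']] .
    then show ?thesis
      using R'.exists_simplicial_nonneighbour[OF _ U(1,2,3)] below finite_subset[OF U(1)] by auto
  qed
  have "unpaired (verts G) {}"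
    unfolding unpaired_def
  proof (intro ballI conjI impI)
    fix y assume y: "y \<in> verts G - {}"
    have "\<exists>u \<in> verts G. u \<noteq> y"
    proof (rule ccontr)
      assume "\<not> ?thesis"
      then have "verts G = {y}" using y by blast
      then show False using G(3) by simp
    qed
    then obtain u where u: "u \<in> verts G" "u \<noteq> y" by blast
    have "(y, u) \<in> rtrancl_on (verts G) (arcs_ends G)"
      using reachable_on_if_connected[OF G.sym_arcs G(2)] y u by blast
    then show "\<exists>v \<in> verts G. y \<rightarrow>\<^bsub>G\<^esub> v"
      by (cases rule: converse_rtrancl_on_cases) (use u in \<open>auto dest: in_rtrancl_on_in_F(1)\<close>)
    fix z assume z: "z \<in> verts G" "z \<noteq> y" "node_below T R (t y) (t z)"
    have "set p \<inter> nodes_of T B z \<noteq> {}"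
      if s: "s \<in> nodes_of T B y" and p: "shortest_path T s p R" for s p
    proof -
      have "node_below T R s (t z)" using le_trans[OF le_top z(3)] y s by blast
      moreover have "vwalk p T" "hd p = s" "last p = R" "set p \<subseteq> verts T"
        using p unfolding shortest_path_def by (auto simp: vpath_def vwalk_def)
      ultimately have "t z \<in> set p"
        using rtrancl_on_of_vwalk[of p T "verts T - {t z}"] unfolding node_below_def by blast
      then show ?thesis using top_in z by blast
    qed
    then have "\<not> good_pair G y z" using none unfolding rooted_good_pair_def by blast
    then show "\<exists>v \<in> verts G. y \<rightarrow>\<^bsub>G\<^esub> v \<and> \<not> z \<rightarrow>\<^bsub>G\<^esub> v"
      using y z unfolding good_pair_def nbhd_def by blast
  qed
  then show ?thesis using matchable_if_unpaired[OF dirac] by simp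
qed

section \<open>Retracting onto a sphere\<close>

lemma sum_support_eq:
  fixes f :: "'a \<Rightarrow> real"
  assumes "finite V" "{v. f v \<noteq> 0} \<subseteq> V"
  shows "(\<Sum>v | f v \<noteq> 0. f v) = sum f V"
  using assms by (intro sum.mono_neutral_left) auto

text \<open>
  The sets \<open>P \<union> \<phi> ` Q\<close> form the boundary complex of a cross-polytope, onto which the simplicial map
  fixing \<open>W\<close> and sending \<open>v \<notin> W\<close> to \<open>\<phi> (\<rho> v)\<close> retracts the complex. The cross-polytope is
  identified with the Euclidean sphere by squaring coordinates.
\<close>

theorem not_contractible_if_cross_polytope_retract:
  fixes K :: "'a set set" and \<phi> \<rho> :: "'a \<Rightarrow> 'a"
  assumes V: "finite V" "W \<subseteq> V" "W \<noteq> {}"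
    and faces: "\<And>S. S \<in> K \<Longrightarrow> S \<subseteq> V"
    and \<rho>: "\<And>v. v \<in> V - W \<Longrightarrow> \<rho> v \<in> W"
    and \<phi>: "\<And>w. w \<in> W \<Longrightarrow> \<phi> w \<in> V - W" "\<And>w. w \<in> W \<Longrightarrow> \<rho> (\<phi> w) = w"
    and sep: "\<And>S v. S \<in> K \<Longrightarrow> v \<in> S - W \<Longrightarrow> \<rho> v \<notin> S"
    and cross: "\<And>P Q. P \<subseteq> W \<Longrightarrow> Q \<subseteq> W \<Longrightarrow> P \<inter> Q = {} \<Longrightarrow> P \<union> \<phi> ` Q \<in> K"
  shows "\<not> contractible_space (realization K)"
proof
  assume contr: "contractible_space (realization K)"
  have finW: "finite W" using V finite_subset by blast
  obtain n where n: "card W = Suc n" using finW V(3) by (metis card_eq_0_iff not0_implies_Suc)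
  obtain e where "bij_betw e {0..<card W} W" using ex_bij_betw_nat_finite[OF finW] by blast
  then have e: "bij_betw e {..n} W" unfolding n by (simp add: atLeast0LessThan lessThan_Suc_atMost)
  define ix where "ix = the_inv_into {..n} e"
  have ix: "ix (e k) = k" if "k \<le> n" for k
    using that e unfolding ix_def bij_betw_def by (simp add: the_inv_into_f_f)
  have eW: "e k \<in> W" if "k \<le> n" for k using that e unfolding bij_betw_def by auto
  have sum_e: "(\<Sum>w \<in> W. h (ix w)) = (\<Sum>k\<le>n. h k)" for h :: "nat \<Rightarrow> real"
    using sum.reindex_bij_betw[OF e, of "\<lambda>w. h (ix w)"] ix by simp
  have e_ix: "e (ix w) = w" if "w \<in> W" for w
    using that e ix unfolding bij_betw_def by auto
  \<comment> \<open>The vertices outside \<open>W\<close> that the retraction sends to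
    \<open>\<phi> w\<close>.\<close>
  define C where "C w = {v \<in> V - W. \<rho> v = w}" for w
  have finC: "finite (C w)" for w using V unfolding C_def by auto
  have \<phi>C: "\<phi> w \<in> C w" if "w \<in> W" for w using \<phi> that unfolding C_def by auto
  have sum_V: "sum h V = (\<Sum>w \<in> W. h w + sum h (C w))" for h :: "'a \<Rightarrow> real"
  proof -
    have "V = W \<union> (\<Union>w \<in> W. C w)" "W \<inter> (\<Union>w \<in> W. C w) = {}"
      using V(2) \<rho> unfolding C_def by auto
    then have "sum h V = sum h W + sum h (\<Union>w \<in> W. C w)"
      using finW finC by (metis finite_UN sum.union_disjoint)
    also have "sum h (\<Union>w \<in> W. C w) = (\<Sum>w \<in> W. sum h (C w))"
      by (rule sum.UNION_disjoint) (use finW finC in \<open>auto simp: C_def\<close>)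
    finally show ?thesis by (simp add: sum.distrib)
  qed
  \<comment> \<open>The positive part of the coordinate belonging to \<open>w\<close> goes to
    \<open>w\<close>, its negative part to \<open>\<phi> w\<close>; squaring turns points of the
    sphere into barycentric coordinates.\<close>
  define f where "f x v = (if v \<in> W then (max 0 (x (ix v)))\<^sup>2
      else if v \<in> \<phi> ` W then (max 0 (- x (ix (\<rho> v))))\<^sup>2 else 0)" for x :: "nat \<Rightarrow> real" and v
  have f_C: "sum (f x) (C w) = (max 0 (- x (ix w)))\<^sup>2" if w: "w \<in> W" for x w
  proof -
    have "sum (f x) (C w) = sum (f x) {\<phi> w}"
    proof (rule sum.mono_neutral_right)
      show "\<forall>v \<in> C w - {\<phi> w}. f x v = 0"
        using \<phi>(2) unfolding f_def C_def by auto
    qed (use finC \<phi>C w in auto)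
    then show ?thesis using \<phi> w unfolding f_def by auto
  qed
  have sq: "(max 0 y)\<^sup>2 + (max 0 (- y))\<^sup>2 = y\<^sup>2" for y :: real by (simp add: max_def)
  have f_sum: "sum (f x) V = (\<Sum>k\<le>n. (x k)\<^sup>2)" for x
  proof -
    have "sum (f x) V = (\<Sum>w \<in> W. (x (ix w))\<^sup>2)"
      unfolding sum_V using f_C by (intro sum.cong) (auto simp: f_def sq)
    then show ?thesis using sum_e[of "\<lambda>k. (x k)\<^sup>2"] by simp
  qed
  have f_supp: "{v. f x v \<noteq> 0} \<in> K" for x
  proof -
    have "{v. f x v \<noteq> 0} = {w \<in> W. x (ix w) > 0} \<union> \<phi> ` {w \<in> W. x (ix w) < 0}" (is "?L = ?R")
    proof
      show "?L \<subseteq> ?R" using \<phi> unfolding f_def by (auto split: if_splits simp: max_def)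
      have "f x (\<phi> w) = (max 0 (- x (ix w)))\<^sup>2" if "w \<in> W" for w
        using \<phi> that unfolding f_def by auto
      moreover have "f x w = (max 0 (x (ix w)))\<^sup>2" if "w \<in> W" for w
        using that unfolding f_def by simp
      ultimately show "?R \<subseteq> ?L" by auto
    qed
    also have "\<dots> \<in> K" by (rule cross) auto
    finally show ?thesis .
  qed
  \<comment> \<open>The weight of \<open>C (e k)\<close> is collected at the antipode of
    \<open>e k\<close>. Coordinates beyond \<open>n\<close> vanish, as \<open>nsphere n\<close>
    demands.\<close>
  define g where "g a k = (if k \<le> n then sqrt (a (e k)) - sqrt (sum a (C (e k))) else 0)"
    for a :: "'a \<Rightarrow> real" and k
  have "retraction_maps (realization K) (nsphere n) g f"
    unfolding retraction_maps_def
  proof (intro conjI ballI)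
    have comp: "continuous_map (realization K) euclideanreal (\<lambda>a. a v)" for v
      unfolding realization_def
      by (intro continuous_map_from_subtopology continuous_map_product_projection) simp
    have sqrt_comp: "continuous_map X euclideanreal (\<lambda>a. sqrt (h a))"
      if "continuous_map X euclideanreal h" for X :: "('a \<Rightarrow> real) topology" and h
      using continuous_map_compose[OF that, of euclideanreal sqrt] continuous_on_real_sqrt[OF continuous_on_id]
      by (simp add: o_def)
    have "continuous_map (realization K) (powertop_real UNIV) g"
      unfolding continuous_map_componentwise_UNIV
    proof
      fix k
      show "continuous_map (realization K) euclideanreal (\<lambda>a. g a k)"
        unfolding g_def
        by (cases "k \<le> n")
          (auto intro!: continuous_map_diff sqrt_comp continuous_map_sum comp finC)
    qed
    moreover have "(\<Sum>k\<le>n. (g a k)\<^sup>2) = 1" if "a \<in> topspace (realization K)" for a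
    proof -
      have a: "\<And>v. 0 \<le> a v" "{v. a v \<noteq> 0} \<in> K" "(\<Sum>v | a v \<noteq> 0. a v) = 1"
        using that unfolding realization_def by auto
      \<comment> \<open>By \<open>sep\<close>, at most one of the two square roots is
        nonzero.\<close>
      have "(g a k)\<^sup>2 = a (e k) + sum a (C (e k))" if k: "k \<le> n" for k
      proof (cases "a (e k) = 0")
        case True
        then show ?thesis using k a(1) by (simp add: g_def sum_nonneg)
      next
        case False
        have "a v = 0" if "v \<in> C (e k)" for v
        proof (rule ccontr)
          assume "a v \<noteq> 0"
          then have "\<rho> v \<notin> {v. a v \<noteq> 0}" using sep[OF a(2), of v] that unfolding C_def by auto
          then show False using False that unfolding C_def by auto
        qed
        then have "sum a (C (e k)) = 0" by simp
        then show ?thesis using k a(1) by (simp add: g_def)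
      qed
      then have "(\<Sum>k\<le>n. (g a k)\<^sup>2) = (\<Sum>k\<le>n. a (e k) + sum a (C (e k)))" by simp
      also have "\<dots> = sum a V"
        unfolding sum_V using sum_e[of "\<lambda>k. a (e k) + sum a (C (e k))"] e_ix by simp
      finally show ?thesis using a sum_support_eq[OF V(1) faces[OF a(2)]] by simp
    qed
    ultimately show "continuous_map (realization K) (nsphere n) g"
      unfolding nsphere by (auto simp: continuous_map_in_subtopology g_def)
    have "continuous_map (nsphere n) (powertop_real UNIV) f"
      unfolding continuous_map_componentwise_UNIV
    proof
      fix v
      show "continuous_map (nsphere n) euclideanreal (\<lambda>x. f x v)"
        unfolding f_def
        by (auto intro!: continuous_map_real_pow continuous_map_real_max continuous_map_minus
            continuous_map_nsphere_projection)
    qed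
    moreover have "(\<Sum>v | f x v \<noteq> 0. f x v) = 1" if "x \<in> topspace (nsphere n)" for x
      using that f_sum[of x] sum_support_eq[OF V(1) faces[OF f_supp]] unfolding nsphere by simp
    moreover have "0 \<le> f x v" for x v unfolding f_def by simp
    ultimately show "continuous_map (nsphere n) (realization K) f"
      unfolding realization_def using f_supp by (auto simp: continuous_map_in_subtopology)
    fix x assume "x \<in> topspace (nsphere n)"
    then have x: "\<And>k. k > n \<Longrightarrow> x k = 0" unfolding nsphere by auto
    show "g (f x) = x"
    proof
      fix k
      show "g (f x) k = x k"
        using x[of k] eW[of k] ix[of k] f_C[of "e k" x]
        by (cases "k \<le> n") (auto simp: g_def f_def)
    qed
  qed
  then have "contractible_space (nsphere n)"
    using contractible_space_retraction_map_image contr unfolding retraction_map_def by blast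
  then show False using non_contractible_space_nsphere by blast
qed

text \<open>Without marks every \<open>\<phi> w\<close> is a true neighbour of \<open>w\<close>.
  Domination provides \<open>\<rho> v\<close> as a neighbour of \<open>v\<close> in
  \<open>W\<close>, so no independent set contains both; and \<open>w\<close> is the only neighbour
  of \<open>\<phi> w\<close> in \<open>W\<close>, so \<open>\<rho>\<close> undoes
  \<open>\<phi>\<close>.\<close>

theorem not_contractible_if_matchable:
  assumes G: "Digraph.graph G" "verts G \<noteq> {}"
    and m: "sgraph.matchable (\<lambda>u v. u \<rightarrow>\<^bsub>G\<^esub> v) (verts G) {}"
  shows "\<not> contractible_space (realization (Ind G))"
proof -
  interpret G: Digraph.graph G by fact
  interpret sgraph "\<lambda>u v. u \<rightarrow>\<^bsub>G\<^esub> v" by (rule sgraph_dominates[OF G(1)])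
  obtain W \<phi> where W: "matched_dominating (verts G) {} W \<phi>" using m unfolding matchable_def by blast
  have WV: "W \<subseteq> verts G" "\<And>w. w \<in> W \<Longrightarrow> \<phi> w \<in> verts G"
    and dom: "verts G \<subseteq> (\<Union>w \<in> W. cnb w)"
    and partner: "\<And>w. w \<in> W \<Longrightarrow> w \<rightarrow>\<^bsub>G\<^esub> \<phi> w"
    using W unfolding matched_dominating_def by auto
  have far: "\<not> v \<rightarrow>\<^bsub>G\<^esub> w" "\<not> v \<rightarrow>\<^bsub>G\<^esub> \<phi> w" "\<not> \<phi> w \<rightarrow>\<^bsub>G\<^esub> v" "\<not> \<phi> v \<rightarrow>\<^bsub>G\<^esub> \<phi> w"
    if "v \<in> W" "w \<in> W" "v \<noteq> w" for v w
    using matched_dominating_outside[OF W that(1,2)] matched_dominating_outside[OF W that(2,1)] that(3)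
    by (auto simp: cnb_def)
  have outside: "\<phi> w \<notin> W" if "w \<in> W" for w
    using far(1)[OF that, of "\<phi> w"] partner[OF that] adj_irrefl by metis
  have "\<forall>v. \<exists>w. v \<in> verts G - W \<longrightarrow> w \<in> W \<and> w \<rightarrow>\<^bsub>G\<^esub> v"
    using dom unfolding cnb_def by fastforce
  then obtain \<rho> where \<rho>: "\<And>v. v \<in> verts G - W \<Longrightarrow> \<rho> v \<in> W \<and> \<rho> v \<rightarrow>\<^bsub>G\<^esub> v" by metis
  show ?thesis
  proof (rule not_contractible_if_cross_polytope_retract)
    show "W \<noteq> {}" using dom G(2) by auto
    show "S \<subseteq> verts G" if "S \<in> Ind G" for S using that unfolding Ind_def by blast
    show "\<phi> w \<in> verts G - W" if "w \<in> W" for w using WV(2) outside that by blast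
    then show "\<rho> (\<phi> w) = w" if "w \<in> W" for w using \<rho>[of "\<phi> w"] far(2)[of "\<rho> (\<phi> w)" w] that by blast
    show "\<rho> v \<notin> S" if "S \<in> Ind G" "v \<in> S - W" for S v
      using that \<rho>[of v] unfolding Ind_def by blast
    show "P \<union> \<phi> ` Q \<in> Ind G" if "P \<subseteq> W" "Q \<subseteq> W" "P \<inter> Q = {}" for P Q
    proof -
      have "\<not> u \<rightarrow>\<^bsub>G\<^esub> v" if "u \<in> P \<union> \<phi> ` Q" "v \<in> P \<union> \<phi> ` Q" for u v
      proof -
        have "\<not> p \<rightarrow>\<^bsub>G\<^esub> p'" if "p \<in> P" "p' \<in> P" for p p'
          using that far(1)[of p p'] adj_irrefl \<open>P \<subseteq> W\<close> by blast
        moreover have "\<not> p \<rightarrow>\<^bsub>G\<^esub> \<phi> q" "\<not> \<phi> q \<rightarrow>\<^bsub>G\<^esub> p" if "p \<in> P" "q \<in> Q" for p q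
          using that far(2,3)[of p q] \<open>P \<subseteq> W\<close> \<open>Q \<subseteq> W\<close> \<open>P \<inter> Q = {}\<close> by blast+
        moreover have "\<not> \<phi> q \<rightarrow>\<^bsub>G\<^esub> \<phi> q'" if "q \<in> Q" "q' \<in> Q" for q q'
          using that far(4)[of q q'] adj_irrefl \<open>Q \<subseteq> W\<close> by blast
        ultimately show ?thesis using that by auto
      qed
      moreover have "P \<union> \<phi> ` Q \<subseteq> verts G" using that WV by auto
      ultimately show ?thesis unfolding Ind_def by blast
    qed
  qed (use WV \<rho> in auto)
qed

theorem theorem3p3:
  fixes G :: "('a, 'e) pre_digraph"
  assumes "Digraph.graph G"
    and "Digraph_Component.connected G"
    and "chordal G"
    and "contractible_space (realization (Ind G))"
  shows "card (verts G) = 1 \<or>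
    (\<forall>(T :: ('n, 'f) pre_digraph) (B :: 'n \<Rightarrow> 'a set) (R :: 'n).
       rooted_tree_model G T B R \<longrightarrow> (\<exists>x y. rooted_good_pair G T B R x y))"
proof (cases "card (verts G) = 1")
  case False
  have "verts G \<noteq> {}" using assms(2) by (simp add: connected_conv)
  then have "\<not> sgraph.matchable (\<lambda>u v. u \<rightarrow>\<^bsub>G\<^esub> v) (verts G) {}"
    using not_contractible_if_matchable[OF assms(1)] assms(4) by blast
  then have "\<exists>x y. rooted_good_pair G T B R x y" if "rooted_tree_model G T B R"
    for T :: "('n, 'f) pre_digraph" and B R
    using matchable_if_no_rooted_good_pair[OF assms(1,2) False that] by blast
  then show ?thesis by blast
qed simp

end
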